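(* Let $m>1$ be an integer. There exists an element of $\mathrm{Sp}(4,\mathbb{Z})$ of order exactly $m$ if and only if $m\in\{2,3,4,5,6,8,10,12\}$.
   Context: $\mathrm{Sp}(4,\mathbb{Z})$ is the group of all $4\times 4$ matrices $A$ with integer entries satisfying $A^{\top}JA=J$, where $J=\begin{pmatrix}0_{2} & I_{2}\\ -I_{2} & 0_{2}\end{pmatrix}$. *)

theory Defs
  imports
    "HOL-Algebra.Multiplicative_Group"
    "Jordan_Normal_Form.Determinant"
begin

definition J4 :: "int mat" where
  "J4 = four_block_mat (0\<^sub>m 2 2) (1\<^sub>m 2) (- 1\<^sub>m 2) (0\<^sub>m 2 2)"

definition Sp4Z :: "int mat monoid" where
  "Sp4Z = \<lparr>carrier = {A \<in> carrier_mat 4 4. transpose_mat A * J4 * A = J4},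
    monoid.mult = (*), one = 1\<^sub>m 4\<rparr>"

lemma J4_carrier [simp]: "J4 \<in> carrier_mat 4 4"
  unfolding J4_def carrier_mat_def by simp

lemma J4_index:
  "J4 $$ (i, j) = (if j = i + 2 then 1 else if i = j + 2 then -1 else 0)" if "i < 4" "j < 4"
  using that by (auto simp: J4_def)

lemma J4_square: "J4 * J4 = - 1\<^sub>m 4"
proof (rule eq_matI)
  fix i j :: nat
  assume "i < dim_row (- 1\<^sub>m 4 :: int mat)" "j < dim_col (- 1\<^sub>m 4 :: int mat)"
  then have ij: "i < 4" "j < 4"
    by auto
  note J = carrier_matD[OF J4_carrier]
  have "(J4 * J4) $$ (i, j) = (\<Sum>k = 0..<4. J4 $$ (i, k) * J4 $$ (k, j))"
    using ij J by (simp add: scalar_prod_def)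
  also have "\<dots> = (\<Sum>k\<in>{0, 1, 2, 3}. J4 $$ (i, k) * J4 $$ (k, j))"
    by (rule sum.cong) auto
  also have "\<dots> = (- 1\<^sub>m 4) $$ (i, j)"
    using ij by (auto simp: J4_index)
  finally show "(J4 * J4) $$ (i, j) = (- 1\<^sub>m 4) $$ (i, j)" .
qed (simp_all add: carrier_matD[OF J4_carrier])

lemma J4_transpose: "transpose_mat J4 = - J4"
proof (rule eq_matI)
  note J = carrier_matD[OF J4_carrier]
  fix i j :: nat
  assume "i < dim_row (- J4)" "j < dim_col (- J4)"
  then show "transpose_mat J4 $$ (i, j) = (- J4) $$ (i, j)"
    using J by (auto simp: J4_index)
qed (simp_all add: carrier_matD[OF J4_carrier])

lemma int_mat_left_right_inverse:
  fixes A B :: "int mat"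
  assumes A: "A \<in> carrier_mat n n" and B: "B \<in> carrier_mat n n" and BA: "B * A = 1\<^sub>m n"
  shows "A * B = 1\<^sub>m n"
proof -
  let ?h = "map_mat (of_int :: int \<Rightarrow> rat)"
  have "?h B * ?h A = 1\<^sub>m n"
    using of_int_hom.mat_hom_mult[OF B A, symmetric] by (simp add: BA of_int_hom.mat_hom_one)
  then have "?h A * ?h B = 1\<^sub>m n"
    using A B by (intro mat_mult_left_right_inverse[where A = "?h B"]) auto
  then have "?h (A * B) = ?h (1\<^sub>m n)"
    by (simp only: of_int_hom.mat_hom_mult[OF A B] of_int_hom.mat_hom_one)
  then show ?thesis
    by (rule of_int_hom.mat_hom_inj)
qed

lemma Sp4Z_inverse:
  assumes A: "A \<in> carrier_mat 4 4" and symp: "transpose_mat A * J4 * A = J4"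
  defines "B \<equiv> - (J4 * transpose_mat A * J4)"
  shows "B \<in> carrier_mat 4 4" "transpose_mat B * J4 * B = J4" "B * A = 1\<^sub>m 4"
proof -
  note J = J4_carrier
  have AT [simp]: "transpose_mat A \<in> carrier_mat 4 4"
    using A by simp
  have ac: "X * Y * Z = X * (Y * Z)"
    if "X \<in> carrier_mat 4 4" "Y \<in> carrier_mat 4 4" "Z \<in> carrier_mat 4 4" for X Y Z :: "int mat"
    using that by (rule assoc_mult_mat)
  have mc: "X * Y \<in> carrier_mat 4 4"
    if "X \<in> carrier_mat 4 4" "Y \<in> carrier_mat 4 4" for X Y :: "int mat"
    using that by (rule mult_carrier_mat)
  have um: "- X * Y = - (X * Y)" "X * - Y = - (X * Y)"
    if "X \<in> carrier_mat 4 4" "Y \<in> carrier_mat 4 4" for X Y :: "int mat"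
    using that by (auto intro: uminus_mult_left_mat uminus_mult_right_mat)
  have uu: "- (- X) = X" for X :: "int mat"
    by (rule uminus_uminus_mat)
  show B: "B \<in> carrier_mat 4 4"
    unfolding B_def using A J by (intro uminus_carrier_mat mc) auto
  have "B * A = - (J4 * (transpose_mat A * J4 * A))"
    unfolding B_def using A J AT by (simp add: um ac mc)
  then show BA: "B * A = 1\<^sub>m 4"
    by (simp only: symp J4_square uu)
  have "A * B = 1\<^sub>m 4"
    by (rule int_mat_left_right_inverse[OF A B BA])
  then have "(A * B) * J4 = J4"
    using left_mult_one_mat[OF J] by simp
  moreover have "(A * B) * J4 = - (A * (J4 * (transpose_mat A * (J4 * J4))))"
    unfolding B_def using A J AT by (simp add: um ac mc)
  moreover have "- (A * (J4 * (transpose_mat A * (J4 * J4)))) = A * (J4 * transpose_mat A)"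
    using A J AT by (simp add: J4_square um mc uu)
  ultimately have AJAT: "A * (J4 * transpose_mat A) = J4"
    by simp
  have BT: "transpose_mat B = - (J4 * (A * J4))"
  proof -
    have "transpose_mat B = - transpose_mat (J4 * transpose_mat A * J4)"
      unfolding B_def by (rule transpose_uminus)
    also have "\<dots> = - (transpose_mat J4 * transpose_mat (J4 * transpose_mat A))"
      by (simp only: transpose_mult[OF mc[OF J AT] J])
    also have "\<dots> = - (transpose_mat J4 * (A * transpose_mat J4))"
      by (simp only: transpose_mult[OF J AT] transpose_transpose)
    also have "\<dots> = - (J4 * (A * J4))"
      using A J by (simp add: J4_transpose um mc uu)
    finally show ?thesis .
  qed
  have JJX: "J4 * (J4 * X) = - X" if "X \<in> carrier_mat 4 4" for X
  proof -
    have "J4 * (J4 * X) = (J4 * J4) * X"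
      using J that by (simp add: ac)
    then show ?thesis
      using that by (simp add: J4_square um)
  qed
  have "transpose_mat B * J4 * B = J4 * (A * (J4 * (J4 * (J4 * (transpose_mat A * J4)))))"
    unfolding BT unfolding B_def using A J AT by (simp add: um ac mc uu)
  also have "\<dots> = - (J4 * ((A * (J4 * transpose_mat A)) * J4))"
    using A J AT by (simp add: um ac mc JJX)
  also have "\<dots> = J4"
    unfolding AJAT by (simp add: JJX uu)
  finally show "transpose_mat B * J4 * B = J4" .
qed

lemma group_Sp4Z: "group Sp4Z"
proof (rule groupI)
  fix A B
  assume "A \<in> carrier Sp4Z" "B \<in> carrier Sp4Z"
  then have A: "A \<in> carrier_mat 4 4" "transpose_mat A * J4 * A = J4"
    and B: "B \<in> carrier_mat 4 4" "transpose_mat B * J4 * B = J4"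
    by (auto simp: Sp4Z_def)
  have ac: "X * Y * Z = X * (Y * Z)"
    if "X \<in> carrier_mat 4 4" "Y \<in> carrier_mat 4 4" "Z \<in> carrier_mat 4 4" for X Y Z :: "int mat"
    using that by (rule assoc_mult_mat)
  have mc: "X * Y \<in> carrier_mat 4 4"
    if "X \<in> carrier_mat 4 4" "Y \<in> carrier_mat 4 4" for X Y :: "int mat"
    using that by (rule mult_carrier_mat)
  have "transpose_mat (A * B) * J4 * (A * B) = transpose_mat B * (transpose_mat A * J4 * A) * B"
    using A(1) B(1) by (simp add: transpose_mult[OF A(1) B(1)] ac mc)
  then have "transpose_mat (A * B) * J4 * (A * B) = J4"
    by (simp only: A(2) B(2))
  then show "A \<otimes>\<^bsub>Sp4Z\<^esub> B \<in> carrier Sp4Z"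
    using A(1) B(1) by (auto simp: Sp4Z_def mc)
next
  show "\<one>\<^bsub>Sp4Z\<^esub> \<in> carrier Sp4Z"
    by (simp add: Sp4Z_def left_mult_one_mat[OF J4_carrier] right_mult_one_mat[OF J4_carrier])
next
  fix A B C
  assume "A \<in> carrier Sp4Z" "B \<in> carrier Sp4Z" "C \<in> carrier Sp4Z"
  then show "A \<otimes>\<^bsub>Sp4Z\<^esub> B \<otimes>\<^bsub>Sp4Z\<^esub> C = A \<otimes>\<^bsub>Sp4Z\<^esub> (B \<otimes>\<^bsub>Sp4Z\<^esub> C)"
    by (auto simp: Sp4Z_def intro: assoc_mult_mat)
next
  fix A
  assume "A \<in> carrier Sp4Z"
  then show "\<one>\<^bsub>Sp4Z\<^esub> \<otimes>\<^bsub>Sp4Z\<^esub> A = A"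
    by (auto simp: Sp4Z_def)
next
  fix A
  assume "A \<in> carrier Sp4Z"
  then have "A \<in> carrier_mat 4 4" "transpose_mat A * J4 * A = J4"
    by (auto simp: Sp4Z_def)
  note inv = Sp4Z_inverse[OF this]
  show "\<exists>B\<in>carrier Sp4Z. B \<otimes>\<^bsub>Sp4Z\<^esub> A = \<one>\<^bsub>Sp4Z\<^esub>"
    using inv by (intro bexI[of _ "- (J4 * transpose_mat A * J4)"]) (simp_all only: Sp4Z_def monoid.simps partial_object.simps mem_Collect_eq)
qed

end

theory Submission
  imports Defs
begin

text \<open>
  Why these orders. For \<open>A\<close> in \<open>Sp(4, \<int>)\<close> put \<open>B = A + A\<inverse>\<close>. Since \<open>A\<inverse> = - J A\<^sup>T J\<close>, the
  matrix \<open>J B\<close> is skew-symmetric, so the characteristic polynomial of \<open>B\<close> is the square of a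
  Pfaffian and \<open>B\<close> already satisfies an integral quadratic equation \<open>B\<^sup>2 - a B + c = 0\<close>
  (\<open>symplectic_sum_quadratic\<close>). Multiplied by \<open>A\<^sup>2\<close>, this says that \<open>A\<close> is a root of
  \<open>f = x\<^sup>4 - a x\<^sup>3 + (c + 2) x\<^sup>2 - a x + 1 = (x\<^sup>2 - r x + 1) (x\<^sup>2 - t x + 1)\<close>,
  where \<open>r, t\<close> are the roots of \<open>u\<^sup>2 - a u + c\<close>.

  If \<open>A\<close> has finite order, its eigenvalues lie on the unit circle, and as \<open>r\<close> and \<open>t\<close> are of the
  form \<open>\<lambda> + \<lambda>\<inverse>\<close>, they are real and lie in \<open>[-2, 2]\<close>. That leaves 19 pairs \<open>(a, c)\<close> of integers:
  15 with \<open>r, t\<close> integral, where both factors of \<open>f\<close> divide \<open>(x\<^sup>1\<^sup>2 - 1)\<^sup>2\<close>, and four in which \<open>f\<close>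
  is the cyclotomic polynomial of index 5, 8, 10 or 12 (\<open>small_trace_pairs\<close>). In each case \<open>f\<close>
  divides \<open>(x\<^sup>k - 1)\<^sup>4\<close> with \<open>k\<close> one of 8, 10, 12. So \<open>A\<^sup>k\<close> is unipotent, and being of finite
  order it is the identity: the order of \<open>A\<close> divides 8, 10 or 12 (\<open>Sp4Z_torsion\<close>). The divisors
  of these three numbers other than 1 are exactly the numbers claimed, and it is enough to exhibit
  elements of order 8, 10 and 12, since their powers realise the divisors.

  The argument on eigenvalues is carried out with the integer sequences \<open>n \<mapsto> (A\<^sup>n)\<^sub>i\<^sub>j\<close>, on which
  polynomials act by shifts. A matrix identity \<open>p(A) = 0\<close> becomes the linear recurrence with
  characteristic polynomial \<open>p\<close>, finite order becomes periodicity, and an eigenvector becomes a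
  geometric sequence.
\<close>

section \<open>Polynomials acting on sequences by shifts\<close>

text \<open>
  The value at \<open>n\<close> of \<open>p(T) s\<close>, where \<open>T\<close> is the shift \<open>(T s) n = s (n + 1)\<close>. It vanishes for
  all \<open>n\<close> iff \<open>s\<close> satisfies the linear recurrence with characteristic polynomial \<open>p\<close>.
\<close>
definition shift_op :: "'a::comm_ring_1 poly \<Rightarrow> (nat \<Rightarrow> 'a) \<Rightarrow> nat \<Rightarrow> 'a" where
  "shift_op p s n = (\<Sum>i\<le>degree p. coeff p i * s (n + i))"

lemma shift_op_0 [simp]: "shift_op 0 s n = 0"
  by (simp add: shift_op_def)

lemma shift_op_zero_seq [simp]: "shift_op p (\<lambda>_. 0) n = 0"
  by (simp add: shift_op_def)

lemma shift_op_pCons [simp]: "shift_op (pCons a p) s n = a * s n + shift_op p s (Suc n)"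
  by (simp add: shift_op_def degree_pCons_eq_if sum.atMost_Suc_shift del: sum.atMost_Suc)

lemma shift_op_add: "shift_op (p + q) s n = shift_op p s n + shift_op q s n"
proof (induction p arbitrary: q n)
  case (pCons a p)
  then show ?case
    by (cases q) (simp add: algebra_simps)
qed simp

lemma shift_op_smult: "shift_op (smult a p) s n = a * shift_op p s n"
  by (induction p arbitrary: n) (simp_all add: algebra_simps)

lemma shift_op_mult: "shift_op (p * q) s n = shift_op p (shift_op q s) n"
  by (induction p arbitrary: n) (simp_all add: shift_op_add shift_op_smult)

lemma shift_op_monom: "shift_op (monom a k) s n = a * s (n + k)"
  by (induction k arbitrary: n) (simp_all add: monom_0 monom_Suc)

lemma shift_op_period: "shift_op (monom 1 k - 1) s n = s (n + k) - s n"
proof -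
  have "monom 1 k - 1 = monom 1 k + [:- 1 :: 'a:]"
    by (simp add: one_pCons)
  then show ?thesis
    by (simp only: shift_op_add shift_op_monom) simp
qed

lemma shift_op_periodic:
  assumes "\<And>n. s (n + m) = s n"
  shows "shift_op p s (n + m) = shift_op p s n"
proof -
  have "s (n + m + i) = s (n + i)" for i
    using assms[of "n + i"] by (simp add: ac_simps)
  then show ?thesis
    by (simp add: shift_op_def)
qed

lemma shift_op_dvd:
  assumes "p dvd q" "\<And>n. shift_op p s n = 0"
  shows "shift_op q s n = 0"
proof -
  obtain r where r: "q = r * p"
    using assms(1) by (auto simp: dvd_def ac_simps)
  have "shift_op p s = (\<lambda>_. 0)"
    using assms(2) by auto
  then show ?thesis
    by (simp add: r shift_op_mult)
qed

section \<open>Recurrences with periodic solutions\<close>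

lemma periodic_mult:
  fixes j :: nat
  assumes "\<And>n. s (n + m) = (s n :: 'a)"
  shows "s (n + m * j) = s n"
proof (induction j)
  case (Suc j)
  then show ?case
    using assms[of "n + m * j"] by (simp add: ac_simps)
qed simp

text \<open>
  A solution of \<open>(T\<^sup>k - 1)\<^sup>2 s = 0\<close> is an arithmetic progression along every residue class modulo
  \<open>k\<close>. Periodicity forces its common difference to vanish.
\<close>
lemma periodic_unipotent_square:
  fixes s :: "nat \<Rightarrow> 'a::{comm_ring_1, ring_char_0, semiring_no_zero_divisors}"
  assumes m: "m > 0" and per: "\<And>n. s (n + m) = s n"
    and sq: "\<And>n. s (n + k + k) - s (n + k) = s (n + k) - s n"
  shows "s (n + k) = s n"
proof -
  define d where "d = s (n + k) - s n"
  have step: "s (n + k * Suc j) - s (n + k * j) = d" for j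
  proof (induction j)
    case (Suc j)
    then show ?case
      using sq[of "n + k * j"] by (simp add: algebra_simps)
  qed (simp add: d_def)
  have "s (n + k * j) = s n + of_nat j * d" for j
  proof (induction j)
    case (Suc j)
    then show ?case
      using step[of j] by (simp add: algebra_simps)
  qed simp
  from this[of m] have "of_nat m * d = 0"
    using periodic_mult[of s m n k, OF per] by (simp add: mult.commute)
  then show ?thesis
    using m by (simp add: d_def)
qed

text \<open>
  The sequence form of the fact that a unipotent matrix of finite order is the identity. The
  exponent is lowered one step at a time by applying the quadratic case to \<open>(T\<^sup>k - 1)\<^sup>N s\<close>,
  which inherits the period of \<open>s\<close>.
\<close>
lemma periodic_unipotent:
  fixes s :: "nat \<Rightarrow> 'a::{idom, ring_char_0}"
  assumes m: "m > 0" and per: "\<And>n. s (n + m) = s n"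
    and nil: "\<And>n. shift_op ((monom 1 k - 1) ^ Suc N) s n = 0"
  shows "s (n + k) = s n"
  using nil
proof (induction N arbitrary: n)
  case 0
  then show ?case by (simp add: shift_op_period)
next
  case (Suc N)
  define E where "E = (monom 1 k - 1 :: 'a poly)"
  define u where "u = shift_op (E ^ N) s"
  have E: "shift_op E v n = v (n + k) - v n" for v n
    unfolding E_def by (rule shift_op_period)
  have u: "shift_op (E ^ Suc N) s = shift_op E u"
    unfolding u_def power_Suc by (rule ext) (rule shift_op_mult)
  have "shift_op E (shift_op E u) n = 0" for n
    using Suc.prems[of n] unfolding E_def[symmetric]
    by (subst (asm) power_Suc) (simp only: shift_op_mult u)
  then have sq: "u (n + k + k) - u (n + k) = u (n + k) - u n" for n
    by (simp only: E) (metis eq_iff_diff_eq_0)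
  have "u (n + m) = u n" for n
    unfolding u_def by (rule shift_op_periodic[where s = s], rule per)
  then have "u (n + k) = u n" for n
    using sq by (rule periodic_unipotent_square[OF m])
  then have "shift_op (E ^ Suc N) s n = 0" for n
    by (simp only: u E diff_self)
  then show ?case
    unfolding E_def by (rule Suc.IH)
qed

lemma geometric_periodic_norm:
  fixes v :: "nat \<Rightarrow> complex"
  assumes m: "m > 0" and per: "\<And>n. v (n + m) = v n"
    and geo: "\<And>n. v (Suc n) = \<mu> * v n" and nz: "v n0 \<noteq> 0"
  shows "norm \<mu> = 1"
proof -
  have "v (n0 + j) = \<mu> ^ j * v n0" for j
    by (induction j) (simp_all add: geo)
  from this[of m] have "\<mu> ^ m = 1"
    using nz by (simp add: per)
  then show ?thesis
    using m power_eq_1_iff[of \<mu> m] by simp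
qed

text \<open>
  With \<open>x\<^sup>2 - r x + 1 = (x - z) (x - z\<inverse>)\<close>, either \<open>w\<close> is itself geometric with ratio \<open>z\<inverse>\<close>, or
  \<open>(T - z\<inverse>) w\<close> is a nonzero geometric sequence with ratio \<open>z\<close>. Periodicity puts \<open>z\<close> on the unit
  circle in both cases, and then \<open>r = z + z\<inverse> = 2 Re z\<close>.
\<close>
lemma periodic_trace_bound:
  fixes w :: "nat \<Rightarrow> complex"
  assumes m: "m > 0" and per: "\<And>n. w (n + m) = w n"
    and rec: "\<And>n. w (n + 2) - r * w (n + 1) + w n = 0" and nz: "w n0 \<noteq> 0"
  shows "\<exists>x::real. r = of_real x \<and> \<bar>x\<bar> \<le> 2"
proof -
  define z where "z = (r + csqrt (r\<^sup>2 - 4)) / 2"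
  have "2 * z - r = csqrt (r\<^sup>2 - 4)"
    by (simp add: z_def field_simps)
  then have "(2 * z - r)\<^sup>2 = r\<^sup>2 - 4"
    by simp
  moreover have "4 * (z * z - r * z + 1) = (2 * z - r)\<^sup>2 - (r\<^sup>2 - 4)"
    by (simp add: power2_eq_square algebra_simps)
  ultimately have "4 * (z * z - r * z + 1) = 0"
    by (simp only: diff_self)
  then have z: "z * z - r * z + 1 = 0"
    by (simp only: mult_eq_0_iff) simp
  then have z0: "z \<noteq> 0"
    by auto
  have r: "r = z + inverse z"
    using z z0 by (simp add: field_simps)
  have "norm z = 1"
  proof (cases "\<forall>n. w (Suc n) = inverse z * w n")
    case True
    have "norm (inverse z) = 1"
      using geometric_periodic_norm[of m w "inverse z", OF m per _ nz] True by auto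
    then show ?thesis
      by (simp add: norm_inverse)
  next
    case False
    define v where "v n = w (Suc n) - inverse z * w n" for n
    obtain n1 where n1: "v n1 \<noteq> 0"
      using False by (auto simp: v_def)
    have "v (n + m) = v n" for n
      using per[of "Suc n"] by (simp add: v_def per)
    moreover have "v (Suc n) = z * v n" for n
    proof -
      have "v (Suc n) - z * v n = (w (n + 2) - r * w (n + 1) + w n) + (z * inverse z - 1) * w n"
        by (simp add: v_def r algebra_simps)
      then show ?thesis
        using rec[of n] z0 by simp
    qed
    ultimately show ?thesis
      using n1 by (rule geometric_periodic_norm[OF m])
  qed
  then have "inverse z = cnj z"
    using complex_norm_square[of z] inverse_unique[of z "cnj z"] by simp
  then have "r = of_real (2 * Re z)"
    using complex_add_cnj[of z] by (simp only: r)
  moreover have "\<bar>2 * Re z\<bar> \<le> 2"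
    using abs_Re_le_cmod[of z] \<open>norm z = 1\<close> by simp
  ultimately show ?thesis
    by blast
qed

section \<open>The possible quartics\<close>

text \<open>
  The hypotheses give \<open>(2 - x) (2 - y) \<ge> 0\<close>, \<open>(2 + x) (2 + y) \<ge> 0\<close>, \<open>(x - y)\<^sup>2 \<ge> 0\<close> and
  \<open>\<bar>x + y\<bar> \<le> 4\<close>. These are inequalities in \<open>a\<close> and \<open>c\<close> with 19 integer solutions. The four
  in which \<open>x, y\<close> are irrational have \<open>{x, y}\<close> equal to \<open>{\<plusminus>\<surd>2}\<close>, \<open>{\<plusminus>\<surd>3}\<close> or plus or minus the
  golden ratio and its conjugate.
\<close>
lemma small_trace_pairs:
  fixes a c :: int and x y :: real
  assumes "\<bar>x\<bar> \<le> 2" "\<bar>y\<bar> \<le> 2" and a: "of_int a = x + y" and c: "of_int c = x * y"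
  shows "(\<exists>r\<in>{-2..2}. \<exists>t\<in>{-2..2}. a = r + t \<and> c = r * t) \<or>
         (a, c) \<in> {(0, -2), (0, -3), (1, -1), (-1, -1)}"
proof -
  have xy: "-2 \<le> x" "x \<le> 2" "-2 \<le> y" "y \<le> 2"
    using assms(1,2) by auto
  have "real_of_int (4 - 2 * a + c) = (2 - x) * (2 - y)"
    by (simp add: a c algebra_simps)
  then have 1: "4 - 2 * a + c \<ge> 0"
    using xy by (metis diff_ge_0_iff_ge mult_nonneg_nonneg of_int_0_le_iff)
  have "real_of_int (4 + 2 * a + c) = (2 + x) * (2 + y)"
    by (simp add: a c algebra_simps)
  moreover have "(2 + x) * (2 + y) \<ge> 0"
    using xy by (intro mult_nonneg_nonneg) auto
  ultimately have 2: "4 + 2 * a + c \<ge> 0"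
    by (metis of_int_0_le_iff)
  have "real_of_int (a * a - 4 * c) = (x - y)\<^sup>2"
    by (simp add: a c algebra_simps power2_eq_square)
  then have 3: "a * a - 4 * c \<ge> 0"
    by (metis of_int_0_le_iff zero_le_power2)
  have "real_of_int a \<le> 4" "real_of_int a \<ge> -4"
    using xy a by auto
  then have a4: "-4 \<le> a" "a \<le> 4"
    by auto
  have aa: "a * a \<le> 16"
    using mult_nonneg_nonneg[of "4 - a" "4 + a"] a4 by (simp add: algebra_simps)
  have c4: "-4 \<le> c" "c \<le> 4"
    using 1 2 3 aa by auto
  have "a \<in> {-4,-3,-2,-1,0,1,2,3,4}"
    using a4 by auto
  moreover have "c \<in> {-4,-3,-2,-1,0,1,2,3,4}"
    using c4 by auto
  ultimately have "(a, c) \<in> {(-4,4), (-3,2), (-2,0), (-1,-2), (0,-4), (-2,1), (-1,0), (0,-1), (1,-2), (0,0),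
      (1,0), (2,0), (2,1), (3,2), (4,4), (0,-2), (0,-3), (1,-1), (-1,-1)}"
    using 1 2 3 by (elim insertE emptyE) simp_all
  moreover have "{-2..2::int} = {-2,-1,0,1,2}"
    by auto
  ultimately show ?thesis
    by (elim insertE emptyE) simp_all
qed

text \<open>
  For \<open>t = -1, 0, 1\<close> the quadratic is the cyclotomic polynomial of index 3, 4, 6, so it divides
  \<open>x\<^sup>1\<^sup>2 - 1\<close>. For \<open>t = \<plusminus>2\<close> it is \<open>(x \<mp> 1)\<^sup>2\<close>, which makes the square on the right necessary.
\<close>
lemma trace_quadratic_dvd:
  fixes t :: int
  assumes "t \<in> {-2..2}"
  shows "[:1, - of_int t, 1:] dvd (monom 1 12 - 1 :: complex poly) ^ 2"
proof -
  define E where "E = (monom 1 12 - 1 :: complex poly)"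
  have E: "E = [:-1,0,0,0,0,0,0,0,0,0,0,0,1:]"
    by (simp add: E_def numeral_eq_Suc monom_Suc monom_0 one_pCons)
  have lin: "[:-1, 1:] dvd E" "[:1, 1:] dvd E"
    by (rule dvdI[of _ _ "[:1,1,1,1,1,1,1,1,1,1,1,1:]"], simp add: E)
       (rule dvdI[of _ _ "[:-1,1,-1,1,-1,1,-1,1,-1,1,-1,1:]"], simp add: E)
  have quad: "[:1,0,1:] dvd E" "[:1,1,1:] dvd E" "[:1,-1,1:] dvd E"
    by (rule dvdI[of _ _ "[:-1,0,1,0,-1,0,1,0,-1,0,1:]"], simp add: E)
       (rule dvdI[of _ _ "[:-1,1,0,-1,1,0,-1,1,0,-1,1:]"], simp add: E,
        rule dvdI[of _ _ "[:-1,-1,0,1,1,0,-1,-1,0,1,1:]"], simp add: E)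
  have "[:1,-2,1:] = [:-1,1::complex:] ^ 2" "[:1,2,1:] = [:1,1::complex:] ^ 2"
    by (simp_all add: power2_eq_square)
  then have "[:1,-2,1:] dvd E ^ 2" "[:1,2,1:] dvd E ^ 2"
    using lin by (simp_all only: dvd_power_same)
  moreover have "[:1,0,1:] dvd E ^ 2" "[:1,1,1:] dvd E ^ 2" "[:1,-1,1:] dvd E ^ 2"
    using quad by (simp_all add: power2_eq_square)
  moreover have "t \<in> {-2,-1,0,1,2}"
    using assms by auto
  ultimately show ?thesis
    unfolding E_def[symmetric] by (elim insertE emptyE) simp_all
qed

lemma palindromic_quartic_factor:
  "[:1, - r, 1:] * [:1, - t, 1:] = [:1, - (r + t), r * t + 2, - (r + t), 1 :: 'a::comm_ring_1:]"
  by (simp add: algebra_simps)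

text \<open>
  The quartic \<open>(z \<mp> 1)\<^sup>4\<close>, which arises when \<open>x = y = \<plusminus>2\<close>, calls for the exponent 4. The cofactors in the proof are
  quotients of \<open>z\<^sup>k - 1\<close> by the cyclotomic polynomials of index 8, 5, 10 and 12.
\<close>
lemma palindromic_quartic_dvd:
  fixes a c :: int and x y :: real
  assumes "\<bar>x\<bar> \<le> 2" "\<bar>y\<bar> \<le> 2" and "of_int a = x + y" and "of_int c = x * y"
  shows "\<exists>k\<in>{8, 10, 12}. [:1, - of_int a, of_int c + 2, - of_int a, 1:]
           dvd (monom 1 k - 1 :: complex poly) ^ 4"
proof -
  let ?E = "\<lambda>k. monom 1 k - 1 :: complex poly"
  have E8: "?E 8 = [:-1,0,0,0,0,0,0,0,1:]"
    and E10: "?E 10 = [:-1,0,0,0,0,0,0,0,0,0,1:]"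
    and E12: "?E 12 = [:-1,0,0,0,0,0,0,0,0,0,0,0,1:]"
    by (simp_all add: numeral_eq_Suc monom_Suc monom_0 one_pCons)
  have pow: "p dvd ?E k \<Longrightarrow> p dvd ?E k ^ 4" for p k
    by (rule dvd_trans[OF _ dvd_power]) simp_all
  have "[:1,0,0,0,1:] dvd ?E 8"
    unfolding E8 by (rule dvdI[of _ _ "[:-1,0,0,0,1:]"]) simp
  moreover have "[:1,1,1,1,1:] dvd ?E 10"
    unfolding E10 by (rule dvdI[of _ _ "[:-1,1,0,0,0,-1,1:]"]) simp
  moreover have "[:1,-1,1,-1,1:] dvd ?E 10"
    unfolding E10 by (rule dvdI[of _ _ "[:-1,-1,0,0,0,1,1:]"]) simp
  moreover have "[:1,0,-1,0,1:] dvd ?E 12"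
    unfolding E12 by (rule dvdI[of _ _ "[:-1,0,-1,0,0,0,1,0,1:]"]) simp
  ultimately have cyc: "[:1,0,0,0,1:] dvd ?E 8 ^ 4" "[:1,1,1,1,1:] dvd ?E 10 ^ 4"
    "[:1,-1,1,-1,1:] dvd ?E 10 ^ 4" "[:1,0,-1,0,1:] dvd ?E 12 ^ 4"
    by (simp_all only: pow)
  from small_trace_pairs[OF assms] show ?thesis
  proof
    assume "\<exists>r\<in>{-2..2}. \<exists>t\<in>{-2..2}. a = r + t \<and> c = r * t"
    then obtain r t where rt: "r \<in> {-2..2}" "t \<in> {-2..2}" and ac: "a = r + t" "c = r * t"
      by blast
    have "[:1, - of_int r, 1:] * [:1, - of_int t, 1:] dvd ?E 12 ^ 2 * ?E 12 ^ 2"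
      by (rule mult_dvd_mono) (rule trace_quadratic_dvd, rule rt)+
    then have "[:1, - of_int a, of_int c + 2, - of_int a, 1:] dvd ?E 12 ^ 4"
      unfolding palindromic_quartic_factor by (simp add: ac flip: power_add)
    then show ?thesis
      by blast
  next
    assume "(a, c) \<in> {(0, -2), (0, -3), (1, -1), (-1, -1)}"
    then show ?thesis
      using cyc by (elim insertE emptyE) simp_all
  qed
qed

text \<open>
  The family \<open>S\<close> stands for the entries of the powers of a matrix, and
  \<open>s0\<close> for one of its diagonal entries.

  The recurrence factors through \<open>T\<^sup>2 - r T + 1\<close> and \<open>T\<^sup>2 - t T + 1\<close>. If neither factor alone kills
  all of \<open>S\<close>, each of them leaves a nonzero periodic sequence that the other kills, so \<open>r\<close> and
  \<open>t\<close> are both real and lie in \<open>[-2, 2]\<close>. If one factor, say with \<open>t\<close>, kills all of \<open>S\<close>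
  (for matrices: \<open>A + A\<inverse>\<close> is the scalar \<open>t\<close>), nothing is known of \<open>r\<close>. Then \<open>s0\<close> shows
  that \<open>t\<close> is an integer, and \<open>(a, c)\<close> can be replaced by \<open>(2 t, t\<^sup>2)\<close>.
\<close>
lemma periodic_integer_family:
  fixes S :: "(nat \<Rightarrow> int) set" and a c :: int
  assumes m: "m > 0" and per: "\<And>s n. s \<in> S \<Longrightarrow> s (n + m) = s n"
    and rec: "\<And>s n. s \<in> S \<Longrightarrow>
      s (n + 4) + (c + 2) * s (n + 2) + s n = a * (s (n + 3) + s (n + 1))"
    and s0: "s0 \<in> S" "s0 0 = 1"
  shows "\<exists>k\<in>{8, 10, 12}. \<forall>s\<in>S. \<forall>n. s (n + k) = s n"
proof -
  define C :: "(nat \<Rightarrow> int) \<Rightarrow> nat \<Rightarrow> complex" where "C s n = of_int (s n)" for s n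
  define Q :: "complex \<Rightarrow> complex poly" where "Q r = [:1, - r, 1:]" for r
  have perC: "C s (n + m) = C s n" if "s \<in> S" for s n
    using per[OF that] by (simp add: C_def)
  have Q: "shift_op (Q r) v n = v (n + 2) - r * v (n + 1) + v n" for r v n
    by (simp add: Q_def algebra_simps)
  have QQ: "shift_op (Q r) (shift_op (Q t) (C s)) n = 0"
    if "s \<in> S" "r + t = of_int a" "r * t = of_int c" for s r t n
  proof -
    have "shift_op (Q r) (shift_op (Q t) (C s)) n
        = of_int (s (n + 4) + (c + 2) * s (n + 2) + s n - a * (s (n + 3) + s (n + 1)))"
      unfolding shift_op_mult[symmetric] Q_def palindromic_quartic_factor that(2,3)
      by (simp add: C_def algebra_simps numeral_eq_Suc)
    then show ?thesis
      using rec[OF that(1), of n] by (simp only: diff_self of_int_0)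
  qed
  define real_traces where "real_traces \<longleftrightarrow> (\<exists>a c :: int. \<exists>x y :: real. \<bar>x\<bar> \<le> 2 \<and> \<bar>y\<bar> \<le> 2 \<and>
    of_int a = x + y \<and> of_int c = x * y \<and>
    (\<forall>s\<in>S. \<forall>n. shift_op [:1, - of_int a, of_int c + 2, - of_int a, 1:] (C s) n = 0))"
  have scalar: real_traces if all: "\<And>s n. s \<in> S \<Longrightarrow> shift_op (Q t) (C s) n = 0" for t
  proof -
    \<comment> \<open>The recurrence at \<open>m - 1\<close>, where the middle term is \<open>s0 m = 1\<close>, expresses \<open>t\<close> by integers.\<close>
    define u where "u = s0 (m + 1) + s0 (m - 1)"
    have "s0 m = 1"
      using per[OF s0(1), of 0] s0(2) by simp
    then have "C s0 (m + 1) - t + C s0 (m - 1) = 0"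
      using all[OF s0(1), of "m - 1"] m by (simp add: Q C_def)
    then have "of_int u = t"
      by (simp add: C_def u_def algebra_simps)
    then have t: "t = of_int u"
      by simp
    have "C s0 0 \<noteq> 0"
      using s0(2) by (simp add: C_def)
    moreover have "C s0 (n + 2) - t * C s0 (n + 1) + C s0 n = 0" for n
      using all[OF s0(1), of n] by (simp only: Q)
    ultimately obtain x :: real where x: "t = of_real x" "\<bar>x\<bar> \<le> 2"
      using periodic_trace_bound[of m "C s0" t 0] m perC[OF s0(1)] by blast
    have "of_int u = x"
      using x(1) t by (metis of_real_eq_iff of_real_of_int_eq)
    moreover have "shift_op [:1, - of_int (u + u), of_int (u * u) + 2, - of_int (u + u), 1:] (C s) n = 0"
      if "s \<in> S" for s n
    proof -
      have "Q t dvd [:1, - of_int (u + u), of_int (u * u) + 2, - of_int (u + u), 1:]"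
        using dvd_triv_left[of "Q t" "Q t"] unfolding Q_def palindromic_quartic_factor
        by (simp add: t)
      then show ?thesis
        by (rule shift_op_dvd) (rule all[OF that])
    qed
    ultimately show real_traces
      unfolding real_traces_def using x(2)
      by (intro exI[of _ "u + u"] exI[of _ "u * u"] exI[of _ x]) auto
  qed
  have nonscalar: "\<exists>x::real. r = of_real x \<and> \<bar>x\<bar> \<le> 2"
    if rt: "r + t = of_int a" "r * t = of_int c" and "s \<in> S" "shift_op (Q t) (C s) n \<noteq> 0" for r t s n
  proof (rule periodic_trace_bound[OF m])
    show "shift_op (Q t) (C s) (n + m) = shift_op (Q t) (C s) n" for n
      by (rule shift_op_periodic) (rule perC[OF that(3)])
    show "shift_op (Q t) (C s) (n + 2) - r * shift_op (Q t) (C s) (n + 1) + shift_op (Q t) (C s) n = 0" for n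
      using QQ[OF that(3) rt, of n] by (simp only: Q)
  qed (rule that(4))
  have real_traces
  proof -
    define d where "d = csqrt (of_int a ^ 2 - 4 * of_int c)"
    define r t where "r = (of_int a + d) / 2" and "t = (of_int a - d) / 2"
    have d2: "d\<^sup>2 = of_int a ^ 2 - 4 * of_int c"
      by (simp add: d_def)
    have sum: "r + t = of_int a"
      by (simp add: r_def t_def field_simps)
    have "r * t = (of_int a ^ 2 - d\<^sup>2) / 4"
      by (simp add: r_def t_def power2_eq_square square_diff_square_factored)
    then have prod: "r * t = of_int c"
      by (simp add: d2)
    show real_traces
    proof (cases "(\<forall>s\<in>S. \<forall>n. shift_op (Q t) (C s) n = 0) \<or> (\<forall>s\<in>S. \<forall>n. shift_op (Q r) (C s) n = 0)")
      case True
      then show ?thesis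
        using scalar by blast
    next
      case False
      then obtain x y :: real where x: "r = of_real x" "\<bar>x\<bar> \<le> 2" and y: "t = of_real y" "\<bar>y\<bar> \<le> 2"
        using nonscalar[OF sum prod] nonscalar[of t r] sum prod by (metis add.commute mult.commute)
      have "of_int a = x + y"
        using sum unfolding x y by (metis of_real_add of_real_eq_iff of_real_of_int_eq)
      moreover have "of_int c = x * y"
        using prod unfolding x y by (metis of_real_mult of_real_eq_iff of_real_of_int_eq)
      moreover have "shift_op [:1, - of_int a, of_int c + 2, - of_int a, 1:] (C s) n = 0"
        if "s \<in> S" for s n
        using QQ[OF that sum prod, of n]
        unfolding shift_op_mult[symmetric] Q_def palindromic_quartic_factor sum prod .
      ultimately show ?thesis
        unfolding real_traces_def using x(2) y(2) by blast
    qed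
  qed
  then obtain a' c' :: int and x y :: real
    where *: "\<bar>x\<bar> \<le> 2" "\<bar>y\<bar> \<le> 2" "of_int a' = x + y" "of_int c' = x * y"
      and f: "\<And>s n. s \<in> S \<Longrightarrow>
        shift_op [:1, - of_int a', of_int c' + 2, - of_int a', 1:] (C s) n = 0"
    unfolding real_traces_def by blast
  obtain k where k: "k \<in> {8, 10, 12}"
    and dvd: "[:1, - of_int a', of_int c' + 2, - of_int a', 1:]
      dvd (monom 1 k - 1 :: complex poly) ^ 4"
    using palindromic_quartic_dvd[OF *] by blast
  have "s (n + k) = s n" if "s \<in> S" for s n
  proof -
    have "shift_op ((monom 1 k - 1) ^ Suc 3) (C s) n = 0" for n
      using shift_op_dvd[OF dvd f[OF that]] by simp
    then have "C s (n + k) = C s n"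
      by (rule periodic_unipotent[where s = "C s", OF m perC[OF that]])
    then show ?thesis
      by (simp add: C_def)
  qed
  then show ?thesis
    using k by blast
qed

section \<open>The integral quadratic equation of \<open>A + A\<inverse>\<close>\<close>

lemma mult_mat4_index:
  fixes X Y :: "'a::comm_semiring_0 mat"
  assumes "X \<in> carrier_mat 4 4" "Y \<in> carrier_mat 4 4" "i < 4" "j < 4"
  shows "(X * Y) $$ (i, j) = X $$ (i, 0) * Y $$ (0, j) + X $$ (i, 1) * Y $$ (1, j)
    + X $$ (i, 2) * Y $$ (2, j) + X $$ (i, 3) * Y $$ (3, j)"
proof -
  have "{0..<4::nat} = {0, 1, 2, 3}"
    by auto
  then show ?thesis
    using assms by (simp add: scalar_prod_def ac_simps)
qed

lemma less_4_cases: "(i::nat) < 4 \<longleftrightarrow> i = 0 \<or> i = 1 \<or> i = 2 \<or> i = 3"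
  by auto

lemma eq_mat4I:
  assumes "A \<in> carrier_mat 4 4" "B \<in> carrier_mat 4 4"
    and "\<And>i j. i \<in> {0, 1, 2, 3} \<Longrightarrow> j \<in> {0, 1, 2, 3} \<Longrightarrow> A $$ (i, j) = B $$ (i, j)"
  shows "A = B"
  using assms by (intro eq_matI) (auto simp: less_4_cases)

text \<open>
  In \<open>2 \<times> 2\<close> blocks, the map \<open>A \<mapsto> - J A\<^sup>T J\<close>, which is inversion on \<open>Sp(4, \<int>)\<close>, exchanges the
  two diagonal blocks, transposes all blocks, and negates the off-diagonal ones.
\<close>
lemma symplectic_dual_index:
  fixes A :: "int mat"
  assumes A: "A \<in> carrier_mat 4 4"
  defines "A' \<equiv> - (J4 * transpose_mat A * J4)"
  shows "A' $$ (0, 0) = A $$ (2, 2)" "A' $$ (0, 1) = A $$ (3, 2)"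
    "A' $$ (1, 0) = A $$ (2, 3)" "A' $$ (1, 1) = A $$ (3, 3)"
    "A' $$ (0, 2) = - A $$ (0, 2)" "A' $$ (0, 3) = - A $$ (1, 2)"
    "A' $$ (1, 2) = - A $$ (0, 3)" "A' $$ (1, 3) = - A $$ (1, 3)"
    "A' $$ (2, 0) = - A $$ (2, 0)" "A' $$ (2, 1) = - A $$ (3, 0)"
    "A' $$ (3, 0) = - A $$ (2, 1)" "A' $$ (3, 1) = - A $$ (3, 1)"
    "A' $$ (2, 2) = A $$ (0, 0)" "A' $$ (2, 3) = A $$ (1, 0)"
    "A' $$ (3, 2) = A $$ (0, 1)" "A' $$ (3, 3) = A $$ (1, 1)"
proof -
  have T: "transpose_mat A \<in> carrier_mat 4 4"
    using A by simp
  then have JT: "J4 * transpose_mat A \<in> carrier_mat 4 4"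
    using J4_carrier mult_carrier_mat by blast
  then have JTJ: "J4 * transpose_mat A * J4 \<in> carrier_mat 4 4"
    using J4_carrier mult_carrier_mat by blast
  have "A' $$ (i, j) = - (J4 * transpose_mat A * J4) $$ (i, j)" if "i < 4" "j < 4" for i j
    unfolding A'_def using that carrier_matD[OF JTJ] by simp
  moreover have "transpose_mat A $$ (i, j) = A $$ (j, i)" if "i < 4" "j < 4" for i j
    using that A by auto
  ultimately show "A' $$ (0, 0) = A $$ (2, 2)" "A' $$ (0, 1) = A $$ (3, 2)"
    "A' $$ (1, 0) = A $$ (2, 3)" "A' $$ (1, 1) = A $$ (3, 3)"
    "A' $$ (0, 2) = - A $$ (0, 2)" "A' $$ (0, 3) = - A $$ (1, 2)"
    "A' $$ (1, 2) = - A $$ (0, 3)" "A' $$ (1, 3) = - A $$ (1, 3)"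
    "A' $$ (2, 0) = - A $$ (2, 0)" "A' $$ (2, 1) = - A $$ (3, 0)"
    "A' $$ (3, 0) = - A $$ (2, 1)" "A' $$ (3, 1) = - A $$ (3, 1)"
    "A' $$ (2, 2) = A $$ (0, 0)" "A' $$ (2, 3) = A $$ (1, 0)"
    "A' $$ (3, 2) = A $$ (0, 1)" "A' $$ (3, 3) = A $$ (1, 1)"
    using A by (simp_all add: mult_mat4_index[OF JT J4_carrier] mult_mat4_index[OF J4_carrier T] J4_index
        del: index_mult_mat index_uminus_mat)
qed

text \<open>
  In \<open>2 \<times> 2\<close> blocks, \<open>B\<close> has \<open>X\<close> and \<open>X\<^sup>T\<close> on the diagonal and \<open>q K\<close> and \<open>r K\<close> off it, where \<open>K\<close> is
  the standard skew-symmetric \<open>2 \<times> 2\<close> matrix. The Cayley-Hamilton equation of \<open>X\<close>, together with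
  \<open>K\<^sup>2 = -1\<close> and \<open>X K + K X\<^sup>T = tr(X) K\<close>, gives \<open>B\<^sup>2 - tr(X) B + (det X + q r) = 0\<close>. For
  symplectic \<open>A\<close> the second summand of \<open>B\<close> is \<open>A\<inverse>\<close>.
\<close>
lemma symplectic_sum_quadratic:
  fixes A :: "int mat"
  assumes A: "A \<in> carrier_mat 4 4"
  defines "B \<equiv> A + - (J4 * transpose_mat A * J4)"
  shows "\<exists>a c. B * B + c \<cdot>\<^sub>m 1\<^sub>m 4 = a \<cdot>\<^sub>m B"
proof -
  define A' where "A' = - (J4 * transpose_mat A * J4)"
  have "transpose_mat A \<in> carrier_mat 4 4"
    using A by simp
  then have A': "A' \<in> carrier_mat 4 4"
    unfolding A'_def using J4_carrier by (metis mult_carrier_mat uminus_carrier_mat)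
  have B_def: "B = A + A'"
    by (simp add: B_def A'_def)
  have B: "B \<in> carrier_mat 4 4"
    using A A' by (simp add: B_def)
  have idx: "B $$ (i, j) = A $$ (i, j) + A' $$ (i, j)" if "i < 4" "j < 4" for i j
    using that A A' by (simp add: B_def)
  define x y z w q r where "x = A $$ (0, 0) + A $$ (2, 2)" and "y = A $$ (0, 1) + A $$ (3, 2)"
    and "z = A $$ (1, 0) + A $$ (2, 3)" and "w = A $$ (1, 1) + A $$ (3, 3)"
    and "q = A $$ (0, 3) - A $$ (1, 2)" and "r = A $$ (2, 1) - A $$ (3, 0)"
  have Bs: "B $$ (0, 0) = x" "B $$ (0, 1) = y" "B $$ (0, 2) = 0" "B $$ (0, 3) = q"
    "B $$ (1, 0) = z" "B $$ (1, 1) = w" "B $$ (1, 2) = - q" "B $$ (1, 3) = 0"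
    "B $$ (2, 0) = 0" "B $$ (2, 1) = r" "B $$ (2, 2) = x" "B $$ (2, 3) = z"
    "B $$ (3, 0) = - r" "B $$ (3, 1) = 0" "B $$ (3, 2) = y" "B $$ (3, 3) = w"
    by (simp_all add: idx symplectic_dual_index[OF A, folded A'_def] x_def y_def z_def w_def q_def r_def
        del: One_nat_def)
  have "B * B + (x * w - y * z + q * r) \<cdot>\<^sub>m 1\<^sub>m 4 = (x + w) \<cdot>\<^sub>m B"
  proof (rule eq_mat4I)
    fix i j :: nat
    assume ij: "i \<in> {0, 1, 2, 3}" "j \<in> {0, 1, 2, 3}"
    have lt: "i < 4" "j < 4"
      using ij by auto
    have "(B * B + (x * w - y * z + q * r) \<cdot>\<^sub>m 1\<^sub>m 4) $$ (i, j)
        = (B * B) $$ (i, j) + (x * w - y * z + q * r) * (if i = j then 1 else 0)"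
      using lt B by simp
    also have "\<dots> = (x + w) * B $$ (i, j)"
      unfolding mult_mat4_index[OF B B lt] using ij
      by (elim insertE emptyE) (simp_all add: Bs[simplified] algebra_simps)
    also have "\<dots> = ((x + w) \<cdot>\<^sub>m B) $$ (i, j)"
      using lt B by simp
    finally show "(B * B + (x * w - y * z + q * r) \<cdot>\<^sub>m 1\<^sub>m 4) $$ (i, j) = ((x + w) \<cdot>\<^sub>m B) $$ (i, j)" .
  qed (use B in auto)
  then show ?thesis
    by blast
qed

section \<open>Torsion of the symplectic group\<close>

lemma Sp4Z_carrierD:
  assumes "A \<in> carrier Sp4Z"
  shows "A \<in> carrier_mat 4 4" "transpose_mat A * J4 * A = J4"
  using assms by (auto simp: Sp4Z_def)

lemma Sp4Z_pow_carrier: "A \<in> carrier Sp4Z \<Longrightarrow> A [^]\<^bsub>Sp4Z\<^esub> (n::nat) \<in> carrier_mat 4 4"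
  by (rule Sp4Z_carrierD) (rule monoid.nat_pow_closed[OF group.is_monoid[OF group_Sp4Z]])

text \<open>
  The quadratic equation of \<open>B = A + A\<inverse>\<close>, multiplied by \<open>A\<^bsup>n+2\<^esup>\<close> and expanded with
  \<open>B A\<^bsup>k+1\<^esup> = A\<^bsup>k+2\<^esup> + A\<^bsup>k\<^esup>\<close>.
\<close>
lemma Sp4Z_power_recurrence:
  assumes A: "A \<in> carrier Sp4Z"
  shows "\<exists>a c :: int. \<forall>i<4. \<forall>j<4. \<forall>n::nat. (A [^]\<^bsub>Sp4Z\<^esub> (n + 4)) $$ (i, j)
      + (c + 2) * (A [^]\<^bsub>Sp4Z\<^esub> (n + 2)) $$ (i, j) + (A [^]\<^bsub>Sp4Z\<^esub> n) $$ (i, j)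
    = a * ((A [^]\<^bsub>Sp4Z\<^esub> (n + 3)) $$ (i, j) + (A [^]\<^bsub>Sp4Z\<^esub> (n + 1)) $$ (i, j))"
proof -
  interpret group Sp4Z
    by (rule group_Sp4Z)
  note A4 = Sp4Z_carrierD[OF A]
  define A' where "A' = - (J4 * transpose_mat A * J4)"
  have A': "A' \<in> carrier_mat 4 4" and A'A: "A' * A = 1\<^sub>m 4"
    using Sp4Z_inverse[OF A4] by (simp_all only: A'_def)
  define B where "B = A + A'"
  have B: "B \<in> carrier_mat 4 4"
    using A4(1) A' by (simp add: B_def)
  define M where "M n = A [^]\<^bsub>Sp4Z\<^esub> (n::nat)" for n
  have M: "M n \<in> carrier_mat 4 4" for n
    unfolding M_def by (rule Sp4Z_pow_carrier[OF A])
  have AM: "A * M n = M (Suc n)" for n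
    using nat_pow_Suc2[OF A, of n] by (simp add: M_def Sp4Z_def)
  have BM: "B * M (Suc n) = M (Suc (Suc n)) + M n" for n
  proof -
    have "A' * M (Suc n) = (A' * A) * M n"
      unfolding AM[symmetric] by (rule assoc_mult_mat[symmetric]) (rule A' A4(1) M)+
    also have "\<dots> = M n"
      using M[of n] by (simp add: A'A)
    finally show ?thesis
      unfolding B_def by (subst add_mult_distrib_mat[OF A4(1) A' M]) (simp add: AM)
  qed
  obtain a c where ac: "B * B + c \<cdot>\<^sub>m 1\<^sub>m 4 = a \<cdot>\<^sub>m B"
    using symplectic_sum_quadratic[OF A4(1)] unfolding B_def A'_def by blast
  have "M (n + 4) $$ (i, j) + (c + 2) * M (n + 2) $$ (i, j) + M n $$ (i, j)
      = a * (M (n + 3) $$ (i, j) + M (n + 1) $$ (i, j))" if ij: "i < 4" "j < 4" for i j n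
  proof -
    have "(B * B + c \<cdot>\<^sub>m 1\<^sub>m 4) * M (n + 2) = B * (B * M (n + 2)) + c \<cdot>\<^sub>m M (n + 2)"
      using B M[of "n + 2"]
      by (simp add: add_mult_distrib_mat[of _ 4 4] mult_smult_assoc_mat[of _ 4 4 _ 4] assoc_mult_mat[of _ 4 4 _ 4 _ 4])
    also have "B * (B * M (n + 2)) = B * M (n + 3) + B * M (n + 1)"
      using BM[of "n + 1"] mult_add_distrib_mat[OF B M M, of "n + 3" "n + 1"]
      by (simp add: numeral_eq_Suc)
    also have "\<dots> = (M (n + 4) + M (n + 2)) + (M (n + 2) + M n)"
      using BM[of "n + 2"] BM[of n] by (simp add: numeral_eq_Suc)
    finally have "(a \<cdot>\<^sub>m B) * M (n + 2) = (M (n + 4) + M (n + 2)) + (M (n + 2) + M n) + c \<cdot>\<^sub>m M (n + 2)"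
      by (simp only: ac)
    moreover have "(a \<cdot>\<^sub>m B) * M (n + 2) = a \<cdot>\<^sub>m (M (n + 3) + M (n + 1))"
      using BM[of "n + 1"] by (simp add: mult_smult_assoc_mat[OF B M] numeral_eq_Suc)
    ultimately have "(a \<cdot>\<^sub>m (M (n + 3) + M (n + 1))) $$ (i, j)
        = ((M (n + 4) + M (n + 2)) + (M (n + 2) + M n) + c \<cdot>\<^sub>m M (n + 2)) $$ (i, j)"
      by simp
    then show ?thesis
      using ij M[of "n + 1"] M[of "n + 2"] M[of "n + 3"] M[of "n + 4"] M[of n]
      by (simp add: algebra_simps)
  qed
  then show ?thesis
    unfolding M_def by blast
qed

lemma Sp4Z_torsion:
  assumes A: "A \<in> carrier Sp4Z" and ord: "group.ord Sp4Z A > 0"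
  shows "\<exists>k\<in>{8, 10, 12::nat}. group.ord Sp4Z A dvd k"
proof -
  interpret group Sp4Z
    by (rule group_Sp4Z)
  define m where "m = ord A"
  define M where "M n = A [^]\<^bsub>Sp4Z\<^esub> (n::nat)" for n
  define S where "S = {\<lambda>n. M n $$ (i, j) | i j. i < 4 \<and> j < 4}"
  obtain a c where rec: "\<And>i j n. i < 4 \<Longrightarrow> j < 4 \<Longrightarrow>
      M (n + 4) $$ (i, j) + (c + 2) * M (n + 2) $$ (i, j) + M n $$ (i, j)
      = a * (M (n + 3) $$ (i, j) + M (n + 1) $$ (i, j))"
    using Sp4Z_power_recurrence[OF A] unfolding M_def by blast
  have M0: "M 0 = 1\<^sub>m 4"
    by (simp add: M_def Sp4Z_def)
  have per: "M (n + m) = M n" for n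
    using A nat_pow_mult[OF A, of n m] pow_ord_eq_1[OF A] by (simp add: M_def m_def)
  have "\<exists>k\<in>{8, 10, 12}. \<forall>s\<in>S. \<forall>n. s (n + k) = s n"
  proof (rule periodic_integer_family)
    show "m > 0"
      using ord by (simp add: m_def)
    show "(\<lambda>n. M n $$ (0, 0)) \<in> S"
      unfolding S_def by (rule CollectI) (rule exI[of _ 0], rule exI[of _ 0], simp)
    show "M 0 $$ (0, 0) = 1"
      by (simp add: M0)
    show "s (n + 4) + (c + 2) * s (n + 2) + s n = a * (s (n + 3) + s (n + 1))" if "s \<in> S" for s n
      using that rec unfolding S_def by blast
  qed (auto simp: S_def per)
  then obtain k where k: "k \<in> {8, 10, 12}" and S: "\<And>s n. s \<in> S \<Longrightarrow> s (n + k) = s n"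
    by blast
  have "M k = M 0"
  proof (rule eq_matI)
    fix i j
    assume "i < dim_row (M 0)" "j < dim_col (M 0)"
    then have "(\<lambda>n. M n $$ (i, j)) \<in> S"
      by (auto simp: S_def M0)
    from S[OF this, of 0] show "M k $$ (i, j) = M 0 $$ (i, j)"
      by simp
  qed (use Sp4Z_pow_carrier[OF A, of k] in \<open>auto simp: M_def Sp4Z_def\<close>)
  then have "A [^]\<^bsub>Sp4Z\<^esub> k = \<one>\<^bsub>Sp4Z\<^esub>"
    by (simp add: M_def)
  then have "ord A dvd k"
    using pow_eq_id[OF A] by blast
  then show ?thesis
    using k by blast
qed

section \<open>Elements of order 8, 10 and 12\<close>

text \<open>Rewrite rules that let the simplifier compute with explicit \<open>4 \<times> 4\<close> matrices.\<close>

lemma mat_of_rows_list_4: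
  "mat_of_rows_list 4 [a, b, c, d] \<in> carrier_mat 4 4"
  by (simp add: mat_of_rows_list_def numeral_eq_Suc)

lemma mat4_mult:
  fixes a0 :: "'a::comm_semiring_0"
  shows "mat_of_rows_list 4 [[a0,a1,a2,a3],[b0,b1,b2,b3],[c0,c1,c2,c3],[d0,d1,d2,d3]]
    * mat_of_rows_list 4 [[x0,x1,x2,x3],[y0,y1,y2,y3],[z0,z1,z2,z3],[w0,w1,w2,w3]]
    = mat_of_rows_list 4
       [[a0*x0+a1*y0+a2*z0+a3*w0, a0*x1+a1*y1+a2*z1+a3*w1, a0*x2+a1*y2+a2*z2+a3*w2, a0*x3+a1*y3+a2*z3+a3*w3],
        [b0*x0+b1*y0+b2*z0+b3*w0, b0*x1+b1*y1+b2*z1+b3*w1, b0*x2+b1*y2+b2*z2+b3*w2, b0*x3+b1*y3+b2*z3+b3*w3],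
        [c0*x0+c1*y0+c2*z0+c3*w0, c0*x1+c1*y1+c2*z1+c3*w1, c0*x2+c1*y2+c2*z2+c3*w2, c0*x3+c1*y3+c2*z3+c3*w3],
        [d0*x0+d1*y0+d2*z0+d3*w0, d0*x1+d1*y1+d2*z1+d3*w1, d0*x2+d1*y2+d2*z2+d3*w2, d0*x3+d1*y3+d2*z3+d3*w3]]"
    (is "?X * ?Y = ?Z")
proof (rule eq_mat4I)
  have X: "?X \<in> carrier_mat 4 4" and Y: "?Y \<in> carrier_mat 4 4"
    by (rule mat_of_rows_list_4)+
  then show "?X * ?Y \<in> carrier_mat 4 4"
    by (rule mult_carrier_mat)
  show "?Z \<in> carrier_mat 4 4"
    by (rule mat_of_rows_list_4)
  fix i j :: nat
  assume ij: "i \<in> {0, 1, 2, 3}" "j \<in> {0, 1, 2, 3}"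
  then have lt: "i < 4" "j < 4"
    by auto
  show "(?X * ?Y) $$ (i, j) = ?Z $$ (i, j)"
    unfolding mult_mat4_index[OF X Y lt] using ij
    by (elim insertE emptyE) (simp_all add: mat_of_rows_list_def)
qed

lemma mat4_transpose:
  "transpose_mat (mat_of_rows_list 4 [[a0,a1,a2,a3],[b0,b1,b2,b3],[c0,c1,c2,c3],[d0,d1,d2,d3]])
    = mat_of_rows_list 4 [[a0,b0,c0,d0],[a1,b1,c1,d1],[a2,b2,c2,d2],[a3,b3,c3,d3]]"
    (is "transpose_mat ?X = ?Z")
proof (rule eq_mat4I)
  show "transpose_mat ?X \<in> carrier_mat 4 4" "?Z \<in> carrier_mat 4 4"
    using mat_of_rows_list_4 by simp_all
  fix i j :: nat
  assume "i \<in> {0, 1, 2, 3}" "j \<in> {0, 1, 2, 3}"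
  then show "transpose_mat ?X $$ (i, j) = ?Z $$ (i, j)"
    by (elim insertE emptyE) (simp_all add: mat_of_rows_list_def)
qed

lemma mat4_one: "1\<^sub>m 4 = mat_of_rows_list 4 [[1,0,0,0],[0,1,0,0],[0,0,1,0],[0,0,0,1]]"
  (is "_ = ?Z")
proof (rule eq_mat4I)
  show "?Z \<in> carrier_mat 4 4"
    by (rule mat_of_rows_list_4)
  fix i j :: nat
  assume "i \<in> {0, 1, 2, 3}" "j \<in> {0, 1, 2, 3}"
  then show "1\<^sub>m 4 $$ (i, j) = ?Z $$ (i, j)"
    by (elim insertE emptyE) (simp_all add: mat_of_rows_list_def)
qed simp

lemma mat4_J: "J4 = mat_of_rows_list 4 [[0,0,1,0],[0,0,0,1],[-1,0,0,0],[0,-1,0,0]]"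
  (is "_ = ?Z")
proof (rule eq_mat4I)
  show "?Z \<in> carrier_mat 4 4"
    by (rule mat_of_rows_list_4)
  fix i j :: nat
  assume "i \<in> {0, 1, 2, 3}" "j \<in> {0, 1, 2, 3}"
  then show "J4 $$ (i, j) = ?Z $$ (i, j)"
    by (elim insertE emptyE) (simp_all add: mat_of_rows_list_def J4_index)
qed simp

lemma mat4_eq_iff:
  "mat_of_rows_list 4 [[a0,a1,a2,a3],[b0,b1,b2,b3],[c0,c1,c2,c3],[d0,d1,d2,d3]]
    = mat_of_rows_list 4 [[x0,x1,x2,x3],[y0,y1,y2,y3],[z0,z1,z2,z3],[w0,w1,w2,w3]]
    \<longleftrightarrow> [a0,a1,a2,a3,b0,b1,b2,b3,c0,c1,c2,c3,d0,d1,d2,d3] = [x0,x1,x2,x3,y0,y1,y2,y3,z0,z1,z2,z3,w0,w1,w2,w3]"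
    (is "?X = ?Y \<longleftrightarrow> ?r")
proof
  assume eq: "?X = ?Y"
  have "?X $$ (i, j) = ?Y $$ (i, j)" for i j
    by (simp only: eq)
  from this[of 0 0] this[of 0 1] this[of 0 2] this[of 0 3] this[of 1 0] this[of 1 1] this[of 1 2] this[of 1 3]
    this[of 2 0] this[of 2 1] this[of 2 2] this[of 2 3] this[of 3 0] this[of 3 1] this[of 3 2] this[of 3 3]
  show ?r
    by (simp add: mat_of_rows_list_def)
qed simp

lemmas mat4_simps = mat4_mult mat4_transpose mat4_one mat4_J mat4_eq_iff

lemma le_12_cases: "(d::nat) \<le> 12 \<Longrightarrow> d \<in> {0,1,2,3,4,5,6,7,8,9,10,11,12}"
  by (auto simp: numeral_eq_Suc le_Suc_eq)

lemma dvd_8_cases: "(d::nat) dvd 8 \<Longrightarrow> \<not> d dvd 4 \<Longrightarrow> d = 8"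
proof -
  assume d: "d dvd 8" "\<not> d dvd 4"
  then have "d \<in> {0,1,2,3,4,5,6,7,8,9,10,11,12}"
    using dvd_imp_le[of d 8] by (intro le_12_cases) auto
  then show "d = 8"
    using d by (elim insertE emptyE) simp_all
qed

lemma dvd_10_cases: "(d::nat) dvd 10 \<Longrightarrow> \<not> d dvd 2 \<Longrightarrow> \<not> d dvd 5 \<Longrightarrow> d = 10"
proof -
  assume d: "d dvd 10" "\<not> d dvd 2" "\<not> d dvd 5"
  then have "d \<in> {0,1,2,3,4,5,6,7,8,9,10,11,12}"
    using dvd_imp_le[of d 10] by (intro le_12_cases) auto
  then show "d = 10"
    using d by (elim insertE emptyE) simp_all
qed

lemma dvd_12_cases: "(d::nat) dvd 12 \<Longrightarrow> \<not> d dvd 4 \<Longrightarrow> \<not> d dvd 6 \<Longrightarrow> d = 12"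
proof -
  assume d: "d dvd 12" "\<not> d dvd 4" "\<not> d dvd 6"
  then have "d \<in> {0,1,2,3,4,5,6,7,8,9,10,11,12}"
    using dvd_imp_le[of d 12] by (intro le_12_cases) auto
  then show "d = 12"
    using d by (elim insertE emptyE) simp_all
qed

lemma Sp4Z_pow_add:
  assumes "A \<in> carrier Sp4Z"
  shows "A [^]\<^bsub>Sp4Z\<^esub> (n + k :: nat) = A [^]\<^bsub>Sp4Z\<^esub> n * A [^]\<^bsub>Sp4Z\<^esub> k"
  using monoid.nat_pow_mult[OF group.is_monoid[OF group_Sp4Z] assms, of n k] by (simp add: Sp4Z_def)

lemma Sp4Z_pow_1: "A \<in> carrier Sp4Z \<Longrightarrow> A [^]\<^bsub>Sp4Z\<^esub> (1 :: nat) = A"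
  by (rule monoid.nat_pow_eone[OF group.is_monoid[OF group_Sp4Z]])

lemma Sp4Z_pow_eq_one_iff:
  "A \<in> carrier Sp4Z \<Longrightarrow> A [^]\<^bsub>Sp4Z\<^esub> (n :: nat) = 1\<^sub>m 4 \<longleftrightarrow> group.ord Sp4Z A dvd n"
  using group.pow_eq_id[OF group_Sp4Z] by (simp add: Sp4Z_def)

text \<open>
  The three witnesses have characteristic polynomials \<open>x\<^sup>4 + 1\<close>,
  \<open>x\<^sup>4 - x\<^sup>3 + x\<^sup>2 - x + 1\<close> and \<open>(x\<^sup>2 + 1) (x\<^sup>2 - x + 1)\<close>; the last is a direct sum of elements of
  order 4 and 6 in two copies of \<open>SL(2, \<int>)\<close>.
\<close>
lemma Sp4Z_order_8: "\<exists>A\<in>carrier Sp4Z. group.ord Sp4Z A = 8"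
proof -
  define A :: "int mat" where
    "A = mat_of_rows_list 4 [[0,-1,0,0],[0,0,-1,0],[0,0,0,-1],[1,0,0,0]]"
  have A: "A \<in> carrier Sp4Z"
    by (simp add: Sp4Z_def A_def mat_of_rows_list_4 mat4_simps)
  note 1 = Sp4Z_pow_1[OF A]
  have 2: "A [^]\<^bsub>Sp4Z\<^esub> (2::nat) = mat_of_rows_list 4 [[0,0,1,0],[0,0,0,1],[-1,0,0,0],[0,-1,0,0]]"
    using Sp4Z_pow_add[OF A, of 1 1] unfolding 1
    by (simp add: A_def mat4_simps del: One_nat_def)
  have 4: "A [^]\<^bsub>Sp4Z\<^esub> (4::nat) = mat_of_rows_list 4 [[-1,0,0,0],[0,-1,0,0],[0,0,-1,0],[0,0,0,-1]]"
    using Sp4Z_pow_add[OF A, of 2 2] unfolding 2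
    by (simp add: mat4_simps del: One_nat_def)
  have 8: "A [^]\<^bsub>Sp4Z\<^esub> (8::nat) = 1\<^sub>m 4"
    using Sp4Z_pow_add[OF A, of 4 4] unfolding 4
    by (simp add: mat4_simps del: One_nat_def)
  have "group.ord Sp4Z A dvd 8"
    using 8 by (simp add: Sp4Z_pow_eq_one_iff[OF A])
  moreover have "\<not> group.ord Sp4Z A dvd 4"
    using 4 by (simp_all add: mat4_simps flip: Sp4Z_pow_eq_one_iff[OF A])
  ultimately have "group.ord Sp4Z A = 8"
    by (rule dvd_8_cases)
  then show ?thesis
    using A by blast
qed

lemma Sp4Z_order_10: "\<exists>A\<in>carrier Sp4Z. group.ord Sp4Z A = 10"
proof -
  define A :: "int mat" where
    "A = mat_of_rows_list 4 [[0,1,-1,0],[1,1,0,-1],[1,0,0,0],[0,1,0,0]]"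
  have A: "A \<in> carrier Sp4Z"
    by (simp add: Sp4Z_def A_def mat_of_rows_list_4 mat4_simps)
  note 1 = Sp4Z_pow_1[OF A]
  have 2: "A [^]\<^bsub>Sp4Z\<^esub> (2::nat) = mat_of_rows_list 4 [[0,1,0,-1],[1,1,-1,-1],[0,1,-1,0],[1,1,0,-1]]"
    using Sp4Z_pow_add[OF A, of 1 1] unfolding 1
    by (simp add: A_def mat4_simps del: One_nat_def)
  have 4: "A [^]\<^bsub>Sp4Z\<^esub> (4::nat) = mat_of_rows_list 4 [[0,0,-1,0],[0,0,0,-1],[1,0,0,-1],[0,1,-1,-1]]"
    using Sp4Z_pow_add[OF A, of 2 2] unfolding 2
    by (simp add: mat4_simps del: One_nat_def)
  have 5: "A [^]\<^bsub>Sp4Z\<^esub> (5::nat) = mat_of_rows_list 4 [[-1,0,0,0],[0,-1,0,0],[0,0,-1,0],[0,0,0,-1]]"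
    using Sp4Z_pow_add[OF A, of 4 1] unfolding 1 4
    by (simp add: A_def mat4_simps del: One_nat_def)
  have 10: "A [^]\<^bsub>Sp4Z\<^esub> (10::nat) = 1\<^sub>m 4"
    using Sp4Z_pow_add[OF A, of 5 5] unfolding 5
    by (simp add: mat4_simps del: One_nat_def)
  have "group.ord Sp4Z A dvd 10"
    using 10 by (simp add: Sp4Z_pow_eq_one_iff[OF A])
  moreover have "\<not> group.ord Sp4Z A dvd 2" "\<not> group.ord Sp4Z A dvd 5"
    using 2 5 by (simp_all add: mat4_simps flip: Sp4Z_pow_eq_one_iff[OF A])
  ultimately have "group.ord Sp4Z A = 10"
    by (rule dvd_10_cases)
  then show ?thesis
    using A by blast
qed

lemma Sp4Z_order_12: "\<exists>A\<in>carrier Sp4Z. group.ord Sp4Z A = 12"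
proof -
  define A :: "int mat" where
    "A = mat_of_rows_list 4 [[0,0,1,0],[0,1,0,1],[-1,0,0,0],[0,-1,0,0]]"
  have A: "A \<in> carrier Sp4Z"
    by (simp add: Sp4Z_def A_def mat_of_rows_list_4 mat4_simps)
  note 1 = Sp4Z_pow_1[OF A]
  have 2: "A [^]\<^bsub>Sp4Z\<^esub> (2::nat) = mat_of_rows_list 4 [[-1,0,0,0],[0,0,0,1],[0,0,-1,0],[0,-1,0,-1]]"
    using Sp4Z_pow_add[OF A, of 1 1] unfolding 1
    by (simp add: A_def mat4_simps del: One_nat_def)
  have 4: "A [^]\<^bsub>Sp4Z\<^esub> (4::nat) = mat_of_rows_list 4 [[1,0,0,0],[0,-1,0,-1],[0,0,1,0],[0,1,0,0]]"
    using Sp4Z_pow_add[OF A, of 2 2] unfolding 2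
    by (simp add: mat4_simps del: One_nat_def)
  have 6: "A [^]\<^bsub>Sp4Z\<^esub> (6::nat) = mat_of_rows_list 4 [[-1,0,0,0],[0,1,0,0],[0,0,-1,0],[0,0,0,1]]"
    using Sp4Z_pow_add[OF A, of 4 2] unfolding 2 4
    by (simp add: mat4_simps del: One_nat_def)
  have 12: "A [^]\<^bsub>Sp4Z\<^esub> (12::nat) = 1\<^sub>m 4"
    using Sp4Z_pow_add[OF A, of 6 6] unfolding 6
    by (simp add: mat4_simps del: One_nat_def)
  have "group.ord Sp4Z A dvd 12"
    using 12 by (simp add: Sp4Z_pow_eq_one_iff[OF A])
  moreover have "\<not> group.ord Sp4Z A dvd 4" "\<not> group.ord Sp4Z A dvd 6"
    using 4 6 by (simp_all add: mat4_simps flip: Sp4Z_pow_eq_one_iff[OF A])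
  ultimately have "group.ord Sp4Z A = 12"
    by (rule dvd_12_cases)
  then show ?thesis
    using A by blast
qed

theorem mainTheorem3:
  fixes m :: nat
  assumes "m > 1"
  shows "(\<exists>A \<in> carrier Sp4Z. group.ord Sp4Z A = m) \<longleftrightarrow> m \<in> {2, 3, 4, 5, 6, 8, 10, 12}"
proof
  assume "\<exists>A \<in> carrier Sp4Z. group.ord Sp4Z A = m"
  then obtain k :: nat where k: "k \<in> {8, 10, 12}" "m dvd k"
    using Sp4Z_torsion assms by (metis gr0I not_one_less_zero)
  then have "m \<in> {0,1,2,3,4,5,6,7,8,9,10,11,12}"
    using dvd_imp_le[of m k] by (intro le_12_cases) auto
  then show "m \<in> {2, 3, 4, 5, 6, 8, 10, 12}"
    using k assms by (elim insertE emptyE) simp_all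
next
  have power: "\<exists>A \<in> carrier Sp4Z. group.ord Sp4Z A = n div d"
    if ex: "\<exists>A \<in> carrier Sp4Z. group.ord Sp4Z A = n" and d: "d dvd n" "d \<noteq> 0" for n d
  proof -
    obtain A where A: "A \<in> carrier Sp4Z" "group.ord Sp4Z A = n"
      using ex by blast
    then have "group.ord Sp4Z (A [^]\<^bsub>Sp4Z\<^esub> d) = n div d"
      using group.ord_pow[OF group_Sp4Z, of A d] d by simp
    then show ?thesis
      using monoid.nat_pow_closed[OF group.is_monoid[OF group_Sp4Z] A(1)] by blast
  qed
  assume "m \<in> {2, 3, 4, 5, 6, 8, 10, 12}"
  then show "\<exists>A \<in> carrier Sp4Z. group.ord Sp4Z A = m"
    using power[OF Sp4Z_order_12, of 2] power[OF Sp4Z_order_12, of 3] power[OF Sp4Z_order_12, of 4]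
      power[OF Sp4Z_order_12, of 6] power[OF Sp4Z_order_10, of 2]
      Sp4Z_order_8 Sp4Z_order_10 Sp4Z_order_12
    by (elim insertE emptyE) simp_all
qed

end
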